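(* Let $k$ be a field of characteristic $p\ge 0$, $H$ a $p$-soluble finite group, $V$ a $kH$-module and $a\in V$ an element which is fixed by a Sylow $p$-subgroup of $H$ and whose $H$-orbit $a^H$ spans $V$ as a $k$-vector space. Then: (a) $\dim_k \mathbf{C}_V(H)\le 1$; and (b) if $b\in V$ and $\gcd(|a^H|,|b^H|)=1$, then $b\in \mathbf{C}_V(H)$.
   Context: The group $H$ acts $k$-linearly on $V$, written $v\mapsto v^h$; $v^H=\{v^h : h\in H\}$ is the $H$-orbit of $v$, and $\mathbf{C}_V(H)=\{v\in V : v^h=v \text{ for all } h\in H\}$. For a prime $p$, a finite group is $p$-soluble if each of its composition factors is either of order $p$ or of order coprime to $p$. Convention for $p=0$: every finite group is "$0$-soluble", and the "Sylow $0$-subgroup" of a finite group is its identity subgroup. *)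

theory Defs
  imports
    Complex_Main
    "HOL-Algebra.SimpleGroups"
    "HOL-Algebra.Group_Action"
    "HOL-Computational_Algebra.Primes"
begin

text \<open>
  The action is a right action: \<open>act h v\<close> stands for \<open>v\<close> raised to \<open>h\<close>, so the product
  \<open>g \<otimes> h\<close> acts as \<open>g\<close> first and \<open>h\<close> second. The space \<open>V\<close> is the whole type \<open>'v\<close>.
\<close>

locale group_module = group H + vector_space scale
  for H :: "('h, 'm) monoid_scheme" (structure)
    and scale :: "'k::field \<Rightarrow> 'v::ab_group_add \<Rightarrow> 'v" +
  fixes act :: "'h \<Rightarrow> 'v \<Rightarrow> 'v"
  assumes act_linear: "h \<in> carrier H \<Longrightarrow> Vector_Spaces.linear scale scale (act h)"
    and act_one: "act \<one> v = v"
    and act_mult: "\<lbrakk>g \<in> carrier H; h \<in> carrier H\<rbrakk> \<Longrightarrow> act (g \<otimes> h) v = act h (act g v)"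

definition fixed_points :: "('h, 'm) monoid_scheme \<Rightarrow> ('h \<Rightarrow> 'v \<Rightarrow> 'v) \<Rightarrow> 'v set" where
  "fixed_points H act = {v. \<forall>h\<in>carrier H. act h v = v}"

text \<open>
  Only the values \<open>S 0, \<dots>, S n\<close> matter. Normality of \<open>S i\<close> in \<open>S (Suc i)\<close> includes that
  \<open>S (Suc i)\<close> is a group, so all these sets are subgroups.
\<close>

definition composition_series ::
    "('g, 'm) monoid_scheme \<Rightarrow> nat \<Rightarrow> (nat \<Rightarrow> 'g set) \<Rightarrow> bool" where
  "composition_series G n S \<longleftrightarrow>
     S 0 = {\<one>\<^bsub>G\<^esub>} \<and> S n = carrier G \<and>
     (\<forall>i<n. S i \<lhd> G\<lparr>carrier := S (Suc i)\<rparr> \<and>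
            simple_group (G\<lparr>carrier := S (Suc i)\<rparr> Mod S i))"

definition composition_factor :: "('g, 'm) monoid_scheme \<Rightarrow> 'g set monoid \<Rightarrow> bool" where
  "composition_factor G K \<longleftrightarrow>
     (\<exists>n S i. composition_series G n S \<and> i < n \<and> K = G\<lparr>carrier := S (Suc i)\<rparr> Mod S i)"

text \<open>The next two definitions are meant for \<open>p\<close> prime or \<open>p = 0\<close>.\<close>

definition p_soluble :: "nat \<Rightarrow> ('g, 'm) monoid_scheme \<Rightarrow> bool" where
  "p_soluble p G \<longleftrightarrow>
     group G \<and> finite (carrier G) \<and>
     (p = 0 \<or> (\<forall>K. composition_factor G K \<longrightarrow> order K = p \<or> coprime (order K) p))"

definition sylow_subgroup :: "nat \<Rightarrow> 'g set \<Rightarrow> ('g, 'm) monoid_scheme \<Rightarrow> bool" where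
  "sylow_subgroup p P G \<longleftrightarrow>
     (if p = 0 then P = {\<one>\<^bsub>G\<^esub>}
      else subgroup P G \<and> card P = p ^ multiplicity p (order G))"

end

theory Submission
  imports Defs "HOL-Algebra.SndIsomorphismGrp"
begin

text \<open>
  Let \<open>X\<close> be the orbit of \<open>a\<close>. The Sylow subgroup fixing \<open>a\<close> makes \<open>card X\<close> prime to \<open>p\<close>, and
  \<open>X\<close> spans \<open>V\<close>, so every vector is a combination \<open>\<Sum>x\<in>X. f x *s x\<close>. The question is whether
  a vector fixed by a subgroup \<open>B\<close> has such a combination whose coefficient function \<open>f\<close> is
  \<open>B\<close>-invariant (lemma \<open>invariant_coefficients_subgroup\<close>). If it does and \<open>B\<close> is transitive
  on \<open>X\<close>, then \<open>f\<close> is constant, so the vector is a multiple of the orbit sum \<open>\<Sum>x\<in>X. x\<close>,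
  which all of \<open>H\<close> fixes. For \<open>B = H\<close> this bounds the dimension of the fixed space. For (b)
  take \<open>B\<close> to be the stabilizer of \<open>b\<close>: coprimality of the two orbit lengths makes it
  transitive on \<open>X\<close>, by counting.

  Invariant coefficients are obtained for any \<open>B\<close> with orbits on \<open>X\<close> of length prime to \<open>p\<close>,
  by climbing the subgroups \<open>S i \<inter> B\<close> for a composition series \<open>S\<close> of \<open>H\<close>. Each is normal in
  the next, with an index dividing the order of a composition factor of \<open>H\<close>, hence equal to
  \<open>p\<close> or prime to \<open>p\<close>. Let \<open>N\<close> be normal in \<open>M\<close>. If the index is prime to \<open>p\<close>, averaging the
  \<open>N\<close>-invariant coefficients over \<open>M/N\<close> makes them \<open>M\<close>-invariant. If the index is the prime
  \<open>p\<close>, an \<open>M\<close>-orbit splits into \<open>1\<close> or \<open>p\<close> orbits of \<open>N\<close>, all of the same length; its length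
  is prime to \<open>p\<close>, so it is a single \<open>N\<close>-orbit and nothing has to be done.

  The case \<open>p = 0\<close> runs through the same argument with \<open>n\<close> prime to \<open>p\<close> read as \<open>\<not> p dvd n\<close>.
  This then says \<open>n \<noteq> 0\<close>, and for every \<open>p\<close> it says that \<open>n\<close> is invertible in the field.
\<close>

section \<open>Composition series\<close>

text \<open>
  A normal subgroup of the quotient is determined by the union of its cosets, a normal
  subgroup of \<open>G\<close> above \<open>N\<close>.
\<close>

lemma (in group) simple_Mod_if_maximal_normal:
  assumes N: "N \<lhd> G" and proper: "N \<noteq> carrier G"
    and max: "\<And>K. \<lbrakk>K \<lhd> G; N \<subseteq> K; K \<noteq> carrier G\<rbrakk> \<Longrightarrow> K = N"
    and fin: "finite (carrier G)"
  shows "simple_group (G Mod N)"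
proof -
  interpret N: normal N G by (rule N)
  interpret Q: group "G Mod N" by (rule N.factorgroup_is_group)
  have finQ: "finite (carrier (G Mod N))"
    using fin by (simp add: carrier_FactGroup)
  show ?thesis
  proof
    have "order (G Mod N) \<noteq> 1"
    proof
      assume "order (G Mod N) = 1"
      then have "card (rcosets N) = 1"
        by (simp add: order_def FactGroup_def)
      then have "card N = card (carrier G)"
        using lagrange[OF N.subgroup_axioms] by (simp add: order_def)
      then show False
        using card_subset_eq[OF fin N.subset] proper by simp
    qed
    then show "1 < order (G Mod N)"
      using Q.order_gt_0_iff_finite finQ by linarith
  next
    fix K assume K: "K \<lhd> G Mod N"
    then have sK: "subgroup K (G Mod N)" by (rule normal_imp_subgroup)
    have U: "\<Union>K = {x \<in> carrier G. N #> x \<in> K}"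
      by (rule N.factgroup_subgroup_union_char[OF sK])
    have "N \<in> K" using subgroup.one_closed[OF sK] by simp
    then have "N \<subseteq> \<Union>K" by blast
    then consider "\<Union>K = carrier G" | "\<Union>K = N"
      using max[OF N.factgroup_subgroup_union_normal[OF K]] by blast
    then show "K = carrier (G Mod N) \<or> K = {\<one>\<^bsub>G Mod N\<^esub>}"
    proof cases
      case 1
      then have "carrier (G Mod N) \<subseteq> K"
        using U by (auto simp: carrier_FactGroup)
      then show ?thesis using subgroup.subset[OF sK] by blast
    next
      case 2
      have "C = N" if "C \<in> K" for C
      proof -
        have "C \<in> carrier (G Mod N)" using that subgroup.subset[OF sK] by (rule subsetD[rotated])
        then obtain x where x: "x \<in> carrier G" "C = N #> x"
          by (auto simp: carrier_FactGroup)
        then have "x \<in> {x \<in> carrier G. N #> x \<in> K}" using that by simp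
        then have "x \<in> N" by (simp only: U[symmetric] 2)
        then show ?thesis using x N.rcos_const by simp
      qed
      then have "K = {N}" using \<open>N \<in> K\<close> by blast
      then show ?thesis by simp
    qed
  qed
qed

lemma (in group) ex_maximal_normal:
  assumes fin: "finite (carrier G)" and "carrier G \<noteq> {\<one>}"
  obtains N where "N \<lhd> G" "N \<noteq> carrier G"
    "\<And>K. \<lbrakk>K \<lhd> G; N \<subseteq> K; K \<noteq> carrier G\<rbrakk> \<Longrightarrow> K = N"
proof -
  let ?A = "{N. N \<lhd> G \<and> N \<noteq> carrier G}"
  have "?A \<subseteq> Pow (carrier G)"
    using normal_imp_subgroup subgroup.subset by blast
  then have "finite ?A" using fin by (meson finite_Pow_iff finite_subset)
  moreover have "?A \<noteq> {}" using one_is_normal assms(2) by blast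
  ultimately have "\<exists>N\<in>?A. \<forall>K\<in>?A. N \<subseteq> K \<longrightarrow> N = K"
    by (rule finite_has_maximal)
  then obtain N where "N \<in> ?A" "\<And>K. K \<in> ?A \<Longrightarrow> N \<subseteq> K \<Longrightarrow> N = K"
    by blast
  then show thesis by (intro that[of N]) auto
qed

text \<open>
  Being \<open>p\<close>-soluble quantifies over all composition series, so it says something only
  because there is one: extend a series of a maximal normal subgroup by one step.
\<close>

lemma composition_series_exists:
  assumes "group G" "finite (carrier G)"
  shows "\<exists>n S. composition_series G n S"
  using assms
proof (induction "order G" arbitrary: G rule: less_induct)
  case less
  interpret group G by (rule less.prems)
  show ?case
  proof (cases "carrier G = {\<one>\<^bsub>G\<^esub>}")
    case True
    then have "composition_series G 0 (\<lambda>_. {\<one>\<^bsub>G\<^esub>})"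
      by (simp add: composition_series_def)
    then show ?thesis by blast
  next
    case False
    then obtain N where N: "N \<lhd> G" "N \<noteq> carrier G"
      and max: "\<And>K. \<lbrakk>K \<lhd> G; N \<subseteq> K; K \<noteq> carrier G\<rbrakk> \<Longrightarrow> K = N"
      using ex_maximal_normal[OF less.prems(2)] by metis
    have sN: "subgroup N G" using N(1) by (rule normal_imp_subgroup)
    have psub: "N \<subset> carrier G" using subgroup.subset[OF sN] N(2) by blast
    have "order (G\<lparr>carrier := N\<rparr>) < order G" "finite (carrier (G\<lparr>carrier := N\<rparr>))"
      using psubset_card_mono[OF less.prems(2) psub] finite_subset[OF _ less.prems(2), of N] psub
      by (auto simp: order_def)
    then obtain n S where S: "composition_series (G\<lparr>carrier := N\<rparr>) n S"
      using less.hyps[OF _ subgroup_imp_group[OF sN]] by blast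
    let ?S = "S(Suc n := carrier G)"
    have "composition_series G (Suc n) ?S"
      unfolding composition_series_def
    proof (intro conjI allI impI)
      show "?S 0 = {\<one>\<^bsub>G\<^esub>}" "?S (Suc n) = carrier G"
        using S by (simp_all add: composition_series_def)
      fix i assume "i < Suc n"
      then consider "i = n" | "i < n" by linarith
      then have "?S i \<lhd> G\<lparr>carrier := ?S (Suc i)\<rparr> \<and>
          simple_group (G\<lparr>carrier := ?S (Suc i)\<rparr> Mod ?S i)"
      proof cases
        case 1
        then show ?thesis
          using S N(1) simple_Mod_if_maximal_normal[OF N max less.prems(2)]
          by (simp add: composition_series_def)
      next
        case 2
        then show ?thesis using S by (simp add: composition_series_def)
      qed
      then show "?S i \<lhd> G\<lparr>carrier := ?S (Suc i)\<rparr>"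
        "simple_group (G\<lparr>carrier := ?S (Suc i)\<rparr> Mod ?S i)" by blast+
    qed
    then show ?thesis by blast
  qed
qed

text \<open>
  Each term is a subgroup of the next one only, so the induction descends from the top.
\<close>

lemma (in group) composition_series_subgroup:
  assumes S: "composition_series G n S" and "i \<le> n"
  shows "subgroup (S i) G"
  using \<open>i \<le> n\<close>
proof (induction rule: inc_induct)
  case base
  then show ?case using S subgroup_self by (simp add: composition_series_def)
next
  case (step j)
  then have "S j \<lhd> G\<lparr>carrier := S (Suc j)\<rparr>"
    using S by (simp add: composition_series_def)
  then show ?case
    using incl_subgroup[OF step.IH] normal_imp_subgroup by blast
qed

section \<open>Indices and normal subgroups\<close>

text \<open>
  By the second isomorphism theorem the left side is \<open>card (N <#> S) * card (N \<inter> S)\<close>, and the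
  order of the subgroup \<open>N <#> S\<close> divides that of \<open>G\<close>. This form without quotients serves
  both for indices of intersections and for orbit lengths.
\<close>

lemma (in group) card_subgroup_mult_normal_dvd:
  assumes N: "N \<lhd> G" and S: "subgroup S G"
  shows "card S * card N dvd order G * card (N \<inter> S)"
proof -
  interpret second_isomorphism_grp N G S
    using N S by (simp add: second_isomorphism_grp_def second_isomorphism_grp_axioms_def)
  let ?NS = "N <#> S"
  have NS: "subgroup ?NS G" by (rule normal_set_mult_subgroup)
  interpret gS: group "G\<lparr>carrier := S\<rparr>" using S by (rule subgroup_imp_group)
  interpret gNS: group "G\<lparr>carrier := ?NS\<rparr>" using NS by (rule subgroup_imp_group)
  have 1: "card (rcosets\<^bsub>G\<lparr>carrier := S\<rparr>\<^esub> (N \<inter> S)) * card (N \<inter> S) = card S"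
    using gS.lagrange normal_imp_subgroup[OF normal_subgrp_intersection_normal]
    by (simp add: order_def Int_commute)
  have "subgroup N (G\<lparr>carrier := ?NS\<rparr>)"
    using subgroup_incl subgroup_axioms NS H_contained_in_set_mult by blast
  then have 2: "card (rcosets\<^bsub>G\<lparr>carrier := ?NS\<rparr>\<^esub> N) * card N = card ?NS"
    using gNS.lagrange by (simp add: order_def)
  have 3: "card (rcosets\<^bsub>G\<lparr>carrier := S\<rparr>\<^esub> (N \<inter> S)) = card (rcosets\<^bsub>G\<lparr>carrier := ?NS\<rparr>\<^esub> N)"
    using normal_intersection_quotient_isom
    by (auto simp: iso_def FactGroup_def dest: bij_betw_same_card)
  have "card S * card N = card ?NS * card (N \<inter> S)"
    using 1 2 3 by (metis mult.assoc mult.commute)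
  moreover have "card ?NS dvd order G"
    using lagrange[OF NS] by (metis dvd_triv_right)
  ultimately show ?thesis by (simp add: mult_dvd_mono)
qed

text \<open>
  This is what lets a subgroup of a \<open>p\<close>-soluble group inherit a series with good indices.
\<close>

lemma (in group) index_Int_dvd:
  assumes N: "N \<lhd> G" and S: "subgroup S G" and fin: "finite (carrier G)"
  shows "card (rcosets\<^bsub>G\<lparr>carrier := S\<rparr>\<^esub> (N \<inter> S)) dvd card (rcosets N)"
proof -
  interpret gS: group "G\<lparr>carrier := S\<rparr>" using S by (rule subgroup_imp_group)
  let ?i = "card (rcosets\<^bsub>G\<lparr>carrier := S\<rparr>\<^esub> (N \<inter> S))"
  have sN: "subgroup N G" by (rule normal_imp_subgroup[OF N])
  have S': "?i * card (N \<inter> S) = card S"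
    using gS.lagrange normal_imp_subgroup[OF normal_Int_subgroup[OF S N]]
    by (simp add: order_def)
  have G': "card (rcosets N) * card N = order G" by (rule lagrange[OF sN])
  have "finite N" "N \<noteq> {}" "finite (N \<inter> S)" "N \<inter> S \<noteq> {}"
    using fin subgroup.subset[OF sN] finite_subset subgroup.one_closed[OF sN]
      subgroup.one_closed[OF S] by auto
  then have pos: "card N > 0" "card (N \<inter> S) > 0" by (simp_all add: card_gt_0_iff)
  have "?i * (card (N \<inter> S) * card N) dvd card (rcosets N) * (card (N \<inter> S) * card N)"
    using card_subgroup_mult_normal_dvd[OF N S] S' G'
    by (metis mult.assoc mult.commute)
  then show ?thesis using pos by simp
qed

section \<open>Orbits of linear actions\<close>

context group_module
begin

lemma act_inv_cancel [simp]:
  assumes "h \<in> carrier H"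
  shows "act (inv h) (act h v) = v" "act h (act (inv h) v) = v"
  using assms act_mult[of h "inv h" v] act_mult[of "inv h" h v] act_one by simp_all

text \<open>
  The library's actions are left actions, so the right action is turned around by inversion.
  Orbits and stabilizers do not change.
\<close>

lemma group_action_inv: "group_action H UNIV (\<lambda>h. act (inv h))"
proof -
  have bij: "bij (act h)" if "h \<in> carrier H" for h
    using that by (intro bij_betwI[where g = "act (inv h)"]) auto
  show ?thesis
    unfolding group_action_def group_hom_def group_hom_axioms_def hom_def
  proof (intro conjI CollectI ballI)
    show "group (BijGroup (UNIV :: 'v set))" by (rule group_BijGroup)
    show "(\<lambda>h. act (inv h)) \<in> carrier H \<rightarrow> carrier (BijGroup UNIV)"
      using bij by (auto simp: BijGroup_def Bij_def)
    fix g h assume gh: "g \<in> carrier H" "h \<in> carrier H"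
    then show "act (inv (g \<otimes> h)) = act (inv g) \<otimes>\<^bsub>BijGroup UNIV\<^esub> act (inv h)"
      using bij by (auto simp: BijGroup_def Bij_def compose_def inv_mult_group act_mult)
  qed (rule group_axioms)
qed

lemma orbit_inv: "orbit H (\<lambda>h. act (inv h)) x = orbit H act x"
proof -
  have "(\<lambda>h. inv h) ` carrier H = carrier H"
  proof (intro equalityI subsetI)
    fix h assume "h \<in> carrier H"
    then have "h = inv (inv h)" "inv h \<in> carrier H" by simp_all
    then show "h \<in> (\<lambda>h. inv h) ` carrier H" by (rule image_eqI)
  qed auto
  then have "(\<lambda>h. act h x) ` (\<lambda>h. inv h) ` carrier H = (\<lambda>h. act h x) ` carrier H"
    by simp
  then show ?thesis by (auto simp: orbit_def Setcompr_eq_image image_image)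
qed

lemma stabilizer_inv: "stabilizer H (\<lambda>h. act (inv h)) x = stabilizer H act x"
proof -
  have "act (inv h) x = x \<longleftrightarrow> act h x = x" if "h \<in> carrier H" for h
    using act_inv_cancel[OF that, of x] by metis
  then show ?thesis by (auto simp: stabilizer_def)
qed

lemma stabilizer_subgroup: "subgroup (stabilizer H act x) H"
  using group_action.stabilizer_subgroup[OF group_action_inv, of x] by (simp add: stabilizer_inv)

lemma orbit_stabilizer: "card (orbit H act x) * card (stabilizer H act x) = order H"
  using group_action.orbit_stabilizer_theorem[OF group_action_inv, of x]
  by (simp add: stabilizer_inv orbit_inv)

lemma orbit_self: "x \<in> orbit H act x"
  unfolding orbit_def using act_one[of x] one_closed by force

lemma act_orbit: "act h y \<in> orbit H act x"
  if h: "h \<in> carrier H" and y: "y \<in> orbit H act x"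
proof -
  obtain g where "g \<in> carrier H" "y = act g x" using y by (auto simp: orbit_def)
  then have "act h y = act (g \<otimes> h) x" "g \<otimes> h \<in> carrier H" using h act_mult by simp_all
  then show ?thesis by (auto simp: orbit_def)
qed

lemma finite_orbit: "finite (carrier H) \<Longrightarrow> finite (orbit H act x)"
  unfolding orbit_def by simp

lemma restrict_group_module:
  assumes "subgroup M H"
  shows "group_module (H\<lparr>carrier := M\<rparr>) scale act"
proof -
  have "M \<subseteq> carrier H" using assms by (rule subgroup.subset)
  then show ?thesis
    using subgroup_imp_group[OF assms] act_linear act_one act_mult vector_space_axioms
    unfolding group_module_def group_module_axioms_def by (simp add: subset_iff)
qed

text \<open>
  An orbit of \<open>H\<close> splits into \<open>k\<close> orbits of the normal subgroup \<open>N\<close> of equal length, which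
  \<open>H/N\<close> permutes transitively. The proof only counts: with \<open>S\<close> the stabilizer of \<open>x\<close>, the
  number \<open>k\<close> is the index of \<open>N <#> S\<close>.
\<close>

lemma orbit_normal_index:
  assumes N: "N \<lhd> H" and fin: "finite (carrier H)"
  obtains k where "card (orbit H act x) = k * card (orbit (H\<lparr>carrier := N\<rparr>) act x)"
    and "k dvd card (rcosets N)"
proof -
  let ?N = "H\<lparr>carrier := N\<rparr>" and ?S = "stabilizer H act x"
  have sN: "subgroup N H" by (rule normal_imp_subgroup[OF N])
  interpret gN: group_module ?N scale act by (rule restrict_group_module[OF sN])
  have NS: "stabilizer ?N act x = N \<inter> ?S"
    using subgroup.subset[OF sN] by (auto simp: stabilizer_def)
  define oM oN m n where o_defs: "oM = card (orbit H act x)" "oN = card (orbit ?N act x)"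
    "m = card ?S" "n = card (N \<inter> ?S)"
  have M: "oM * m = order H" using orbit_stabilizer by (simp add: o_defs)
  have N': "oN * n = card N" using gN.orbit_stabilizer[of x] NS by (simp add: o_defs order_def)
  have L: "card (rcosets N) * card N = order H" by (rule lagrange[OF sN])
  have finS: "finite ?S" using fin by (simp add: stabilizer_def)
  have "\<one> \<in> N \<inter> ?S" using sN stabilizer_subgroup subgroup.one_closed by blast
  then have pos: "m > 0" "n > 0" using finS by (auto simp: o_defs card_gt_0_iff)
  have oN: "oN > 0"
    using gN.orbit_self gN.finite_orbit fin subgroup.subset[OF sN] finite_subset
    by (fastforce simp: o_defs card_gt_0_iff)
  have "m * card N dvd order H * n"
    using card_subgroup_mult_normal_dvd[OF N stabilizer_subgroup] by (simp add: o_defs)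
  then have "oN * (m * n) dvd oM * (m * n)"
    by (simp flip: M N' add: ac_simps)
  then have "oN dvd oM" using pos by simp
  then obtain k where k: "oM = k * oN" by (metis dvd_def mult.commute)
  interpret gS: group "H\<lparr>carrier := ?S\<rparr>"
    using stabilizer_subgroup by (rule subgroup_imp_group)
  have "n dvd m"
    using gS.lagrange[OF normal_imp_subgroup[OF normal_Int_subgroup[OF stabilizer_subgroup N]],
        symmetric]
    by (simp add: o_defs order_def)
  then obtain j where j: "m = n * j" by blast
  have "card (rcosets N) * (oN * n) = (k * j) * (oN * n)"
    using M N' L unfolding k j by (simp add: ac_simps)
  then have "card (rcosets N) = k * j" using oN pos by simp
  then have "k dvd card (rcosets N)" by simp
  with k show thesis by (intro that[of k]) (simp_all add: o_defs)
qed

end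

section \<open>Invariant coefficients\<close>

text \<open>
  The subgroup \<open>N\<close> enters only through its elements, so a plain set suffices, and every
  subgroup of the series can be treated against the same \<open>X\<close>.
\<close>

definition invariant_coefficients ::
    "('k \<Rightarrow> 'v \<Rightarrow> 'v::comm_monoid_add) \<Rightarrow> ('h \<Rightarrow> 'v \<Rightarrow> 'v) \<Rightarrow> 'v set \<Rightarrow> 'h set \<Rightarrow> bool" where
  "invariant_coefficients scale act X N \<longleftrightarrow>
     (\<forall>v. (\<forall>h\<in>N. act h v = v) \<longrightarrow>
        (\<exists>f. (\<forall>h\<in>N. \<forall>x\<in>X. f (act h x) = f x) \<and> v = (\<Sum>x\<in>X. scale (f x) x)))"

context group_module
begin

notation scale (infixr \<open>*s\<close> 75)

lemma invariant_coefficients_trivial: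
  assumes "finite X" "span X = UNIV"
  shows "invariant_coefficients scale act X {\<one>}"
  unfolding invariant_coefficients_def
proof (intro allI impI)
  fix v
  have "v \<in> range (\<lambda>u. \<Sum>v\<in>X. u v *s v)" using assms span_finite by blast
  then show "\<exists>f. (\<forall>h\<in>{\<one>}. \<forall>x\<in>X. f (act h x) = f x) \<and> v = (\<Sum>x\<in>X. f x *s x)"
    using act_one by auto
qed

text \<open>
  Maschke's averaging, applied to coefficient functions: if \<open>v\<close> is fixed by \<open>t\<close>, then
  \<open>\<lambda>x. f (act t x)\<close> are again coefficients of \<open>v\<close>, and they depend only on the coset of \<open>t\<close>.
  Only the index of \<open>N\<close> has to be inverted, not the order of \<open>H\<close>.
\<close>

lemma invariant_coefficients_coprime_index:
  assumes N: "N \<lhd> H" and fin: "finite (carrier H)"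
    and index: "of_nat (card (rcosets N)) \<noteq> (0 :: 'k)"
    and X: "\<And>h x. h \<in> carrier H \<Longrightarrow> x \<in> X \<Longrightarrow> act h x \<in> X"
    and IH: "invariant_coefficients scale act X N"
  shows "invariant_coefficients scale act X (carrier H)"
  unfolding invariant_coefficients_def
proof (intro allI impI)
  fix v assume v: "\<forall>h\<in>carrier H. act h v = v"
  interpret N: normal N H by (rule N)
  obtain f where f: "\<And>h x. h \<in> N \<Longrightarrow> x \<in> X \<Longrightarrow> f (act h x) = f x"
    and vf: "v = (\<Sum>x\<in>X. f x *s x)"
    using IH v N.subset unfolding invariant_coefficients_def by blast
  let ?Q = "H Mod N"
  interpret Q: group ?Q by (rule N.factorgroup_is_group)
  define g where "g C x = f (act (SOME t. t \<in> C) x)" for C x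
  \<comment> \<open>By normality the representative is \<open>t \<otimes> n\<close>, so \<open>n\<close> acts last, where \<open>f\<close> absorbs it.\<close>
  have g: "g (N #> t) x = f (act t x)" if t: "t \<in> carrier H" and x: "x \<in> X" for t x
  proof -
    have "t \<in> N #> t" using t N.subgroup_axioms by (rule rcos_self)
    then have "(SOME t'. t' \<in> N #> t) \<in> t <# N"
      using someI_ex[of "\<lambda>t'. t' \<in> N #> t"] N.coset_eq t by blast
    then obtain n where n: "n \<in> N" "(SOME t'. t' \<in> N #> t) = t \<otimes> n"
      unfolding l_coset_def by blast
    then show ?thesis
      using t x f X N.subset by (simp add: g_def act_mult subset_iff)
  qed
  define c where "c = (of_nat (card (rcosets N)) :: 'k)"
  define f' where "f' x = (\<Sum>C\<in>carrier ?Q. g C x) / c" for x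
  have invar: "f' (act h x) = f' x" if h: "h \<in> carrier H" and x: "x \<in> X" for h x
  proof -
    have hQ: "N #> h \<in> carrier ?Q" using h by (auto simp: carrier_FactGroup)
    have "g C (act h x) = g ((N #> h) \<otimes>\<^bsub>?Q\<^esub> C) x" if C: "C \<in> carrier ?Q" for C
    proof -
      obtain t where t: "t \<in> carrier H" "C = N #> t" using C by (auto simp: carrier_FactGroup)
      then show ?thesis using h x X by (simp add: N.rcos_sum g act_mult)
    qed
    then have "(\<Sum>C\<in>carrier ?Q. g C (act h x)) = (\<Sum>C\<in>carrier ?Q. g ((N #> h) \<otimes>\<^bsub>?Q\<^esub> C) x)"
      by simp
    also have "\<dots> = (\<Sum>C\<in>carrier ?Q. g C x)"
    proof (rule sum.reindex_bij_betw)
      show "bij_betw ((\<otimes>\<^bsub>?Q\<^esub>) (N #> h)) (carrier ?Q) (carrier ?Q)"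
        using hQ Q.inj_on_cmult Q.surj_const_mult by (auto simp: bij_betw_def)
    qed
    finally show ?thesis by (simp add: f'_def)
  qed
  \<comment> \<open>Apply \<open>inv t\<close> to the combination for \<open>v\<close> and substitute \<open>act t x\<close> for \<open>x\<close>.\<close>
  have move: "v = (\<Sum>x\<in>X. g C x *s x)" if C: "C \<in> carrier ?Q" for C
  proof -
    obtain t where t: "t \<in> carrier H" "C = N #> t" using C by (auto simp: carrier_FactGroup)
    interpret L: Vector_Spaces.linear scale scale "act (inv t)" using act_linear t(1) by simp
    have "v = act (inv t) v" using v t(1) by simp
    also have "\<dots> = (\<Sum>x\<in>X. f x *s act (inv t) x)"
      unfolding vf by (simp add: L.sum L.scale)
    also have "\<dots> = (\<Sum>x\<in>X. f (act t x) *s x)"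
      using t(1) X
      by (intro sum.reindex_bij_witness[where i = "act t" and j = "act (inv t)"]) auto
    also have "\<dots> = (\<Sum>x\<in>X. g C x *s x)" using g t by simp
    finally show ?thesis .
  qed
  have "(\<Sum>x\<in>X. f' x *s x) = (1 / c) *s (\<Sum>x\<in>X. \<Sum>C\<in>carrier ?Q. g C x *s x)"
    by (simp add: f'_def scale_sum_right scale_sum_left sum_divide_distrib)
  also have "\<dots> = (1 / c) *s (\<Sum>C\<in>carrier ?Q. v)"
    using move by (subst sum.swap) simp
  also have "(\<Sum>C\<in>carrier ?Q. v) = c *s v"
    by (simp add: c_def FactGroup_def sum_constant_scale)
  also have "(1 / c) *s (c *s v) = v" using index by (simp add: c_def)
  finally show "\<exists>f. (\<forall>h\<in>carrier H. \<forall>x\<in>X. f (act h x) = f x) \<and> v = (\<Sum>x\<in>X. f x *s x)"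
    using invar by metis
qed

lemma invariant_coefficients_same_orbits:
  assumes orb: "\<And>x. x \<in> X \<Longrightarrow> orbit H act x = orbit (H\<lparr>carrier := N\<rparr>) act x"
    and NH: "N \<subseteq> carrier H"
    and IH: "invariant_coefficients scale act X N"
  shows "invariant_coefficients scale act X (carrier H)"
  unfolding invariant_coefficients_def
proof (intro allI impI)
  fix v assume v: "\<forall>h\<in>carrier H. act h v = v"
  obtain f where f: "\<And>h x. h \<in> N \<Longrightarrow> x \<in> X \<Longrightarrow> f (act h x) = f x"
    and vf: "v = (\<Sum>x\<in>X. f x *s x)"
    using IH v NH unfolding invariant_coefficients_def by blast
  have "f (act h x) = f x" if "h \<in> carrier H" "x \<in> X" for h x
  proof -
    have "act h x \<in> orbit (H\<lparr>carrier := N\<rparr>) act x"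
      using that orb act_orbit orbit_self by blast
    then show ?thesis using f that by (auto simp: orbit_def)
  qed
  then show "\<exists>f. (\<forall>h\<in>carrier H. \<forall>x\<in>X. f (act h x) = f x) \<and> v = (\<Sum>x\<in>X. f x *s x)"
    using vf by metis
qed

text \<open>
  In the case of index \<open>p\<close>, averaging would divide by zero; instead, the number of \<open>N\<close>-orbits
  in an orbit of length prime to \<open>p\<close> divides \<open>p\<close> without being \<open>p\<close>, so it is \<open>1\<close>.
\<close>

lemma invariant_coefficients_step:
  assumes N: "N \<lhd> H" and fin: "finite (carrier H)"
    and p: "CHAR('k) = p"
    and index: "card (rcosets N) = p \<or> \<not> p dvd card (rcosets N)"
    and X: "\<And>h x. h \<in> carrier H \<Longrightarrow> x \<in> X \<Longrightarrow> act h x \<in> X"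
    and orb: "\<And>x. x \<in> X \<Longrightarrow> \<not> p dvd card (orbit H act x)"
    and IH: "invariant_coefficients scale act X N"
  shows "invariant_coefficients scale act X (carrier H)"
proof (cases "p dvd card (rcosets N)")
  case False
  then show ?thesis
    using invariant_coefficients_coprime_index[OF N fin _ X IH] p
    by (simp add: of_nat_eq_0_iff_char_dvd)
next
  case True
  then have idx: "card (rcosets N) = p" using index by blast
  have sN: "subgroup N H" by (rule normal_imp_subgroup[OF N])
  have "card (rcosets N) * card N = order H" by (rule lagrange[OF sN])
  then have "p \<noteq> 0" using idx fin order_gt_0_iff_finite by (metis less_not_refl mult_0)
  then have "prime p" using prime_CHAR_semidom[where 'a = 'k] p by simp
  have "orbit H act x = orbit (H\<lparr>carrier := N\<rparr>) act x" if x: "x \<in> X" for x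
  proof -
    obtain k where k: "card (orbit H act x) = k * card (orbit (H\<lparr>carrier := N\<rparr>) act x)"
      "k dvd p"
      using orbit_normal_index[OF N fin] idx by metis
    then have "k \<noteq> p" using orb[OF x] by auto
    then have "k = 1" using k(2) \<open>prime p\<close> unfolding prime_nat_iff by blast
    moreover have "orbit (H\<lparr>carrier := N\<rparr>) act x \<subseteq> orbit H act x"
      using subgroup.subset[OF sN] by (auto simp: orbit_def)
    ultimately show ?thesis using card_subset_eq[OF finite_orbit[OF fin]] k(1) by (metis mult_1)
  qed
  then show ?thesis
    using invariant_coefficients_same_orbits[OF _ subgroup.subset[OF sN] IH] by blast
qed

text \<open>
  The orbit condition is passed down from \<open>B\<close> along the series \<open>T\<close>, because orbit lengths of
  a normal subgroup divide those of the group; invariance is then passed up, from \<open>{\<one>}\<close>.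
\<close>

lemma invariant_coefficients_subgroup:
  assumes fin: "finite (carrier H)"
    and p: "CHAR('k) = p"
    and sol: "p_soluble p H"
    and B: "subgroup B H"
    and finX: "finite X" and spanX: "span X = UNIV"
    and X: "\<And>h x. h \<in> carrier H \<Longrightarrow> x \<in> X \<Longrightarrow> act h x \<in> X"
    and orb: "\<And>x. x \<in> X \<Longrightarrow> \<not> p dvd card (orbit (H\<lparr>carrier := B\<rparr>) act x)"
  shows "invariant_coefficients scale act X B"
proof -
  obtain n S where S: "composition_series H n S"
    using composition_series_exists[OF group_axioms fin] by blast
  have sS: "subgroup (S i) H" if "i \<le> n" for i
    using composition_series_subgroup[OF S that] .
  define T where "T i = S i \<inter> B" for i
  have sT: "subgroup (T i) H" if "i \<le> n" for i
    using subgroups_Inter_pair[OF sS[OF that] B] by (simp add: T_def)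
  have Tn: "T n = B"
    using S subgroup.subset[OF B] by (auto simp: T_def composition_series_def)
  have T0: "T 0 = {\<one>}"
    using S subgroup.one_closed[OF B] by (auto simp: T_def composition_series_def)
  have step: "T i \<lhd> H\<lparr>carrier := T (Suc i)\<rparr> \<and>
      (card (rcosets\<^bsub>H\<lparr>carrier := T (Suc i)\<rparr>\<^esub> T i) = p \<or>
       \<not> p dvd card (rcosets\<^bsub>H\<lparr>carrier := T (Suc i)\<rparr>\<^esub> T i))" if i: "i < n" for i
  proof -
    let ?M = "H\<lparr>carrier := S (Suc i)\<rparr>"
    let ?q = "card (rcosets\<^bsub>?M\<^esub> S i)" and ?q' = "card (rcosets\<^bsub>H\<lparr>carrier := T (Suc i)\<rparr>\<^esub> T i)"
    have sM: "subgroup (S (Suc i)) H" using sS i by simp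
    interpret M: group ?M using sM by (rule subgroup_imp_group)
    have nM: "S i \<lhd> ?M" using S i by (simp add: composition_series_def)
    have "S i \<subseteq> S (Suc i)" using subgroup.subset[OF normal_imp_subgroup[OF nM]] by simp
    then have T: "T i = S i \<inter> T (Suc i)" by (auto simp: T_def)
    have sT': "subgroup (T (Suc i)) ?M"
      using subgroup_incl[OF sT sM] i by (auto simp: T_def)
    have finM: "finite (carrier ?M)"
      using finite_subset[OF subgroup.subset[OF sM] fin] by simp
    have norm: "T i \<lhd> H\<lparr>carrier := T (Suc i)\<rparr>"
      using M.normal_Int_subgroup[OF sT' nM] T by simp
    have dvd: "?q' dvd ?q"
      using M.index_Int_dvd[OF nM sT' finM] T by simp
    have qpos: "?q > 0"
      using M.lagrange[OF normal_imp_subgroup[OF nM]] M.order_gt_0_iff_finite finM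
      by (metis gr0I less_not_refl mult_0)
    have "composition_factor H (?M Mod S i)"
      using S i by (auto simp: composition_factor_def)
    then have q: "p = 0 \<or> ?q = p \<or> coprime ?q p"
      using sol by (auto simp: p_soluble_def order_def FactGroup_def)
    have "?q' = p \<or> \<not> p dvd ?q'"
    proof (cases "p = 0")
      case True
      then show ?thesis using dvd qpos by auto
    next
      case False
      then have pr: "prime p" using prime_CHAR_semidom[where 'a = 'k] p by simp
      show ?thesis
      proof (cases "?q = p")
        case True
        then show ?thesis using dvd pr dvd_antisym by metis
      next
        case False
        then have "coprime ?q p" using q \<open>p \<noteq> 0\<close> by blast
        then have "\<not> p dvd ?q" using pr by (metis coprime_absorb_right not_prime_unit)
        then show ?thesis using dvd dvd_trans by blast
      qed
    qed
    with norm show ?thesis by blast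
  qed
  have orbT: "\<not> p dvd card (orbit (H\<lparr>carrier := T i\<rparr>) act x)" if "i \<le> n" "x \<in> X" for i x
    using \<open>i \<le> n\<close>
  proof (induction rule: inc_induct)
    case base
    then show ?case using orb \<open>x \<in> X\<close> Tn by simp
  next
    case (step j)
    interpret M: group_module "H\<lparr>carrier := T (Suc j)\<rparr>" scale act
      using restrict_group_module[OF sT] step.hyps by simp
    have "finite (carrier (H\<lparr>carrier := T (Suc j)\<rparr>))"
      using finite_subset[OF subgroup.subset[OF sT] fin] step.hyps by simp
    then obtain k where "card (orbit (H\<lparr>carrier := T (Suc j)\<rparr>) act x) =
        k * card (orbit (H\<lparr>carrier := T j\<rparr>) act x)"
      using M.orbit_normal_index[of "T j" x] \<open>\<And>i. i < n \<Longrightarrow> _\<close>[of j] step.hyps by auto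
    then show ?case using step.IH by auto
  qed
  have "invariant_coefficients scale act X (T i)" if "i \<le> n" for i
    using that
  proof (induction i)
    case 0
    then show ?case using invariant_coefficients_trivial[OF finX spanX] T0 by simp
  next
    case (Suc i)
    interpret M: group_module "H\<lparr>carrier := T (Suc i)\<rparr>" scale act
      using restrict_group_module[OF sT] Suc.prems by simp
    have sub: "T (Suc i) \<subseteq> carrier H" using subgroup.subset[OF sT] Suc.prems by simp
    show ?case
      using M.invariant_coefficients_step[of "T i" p X] step[of i] Suc p X sub orbT
        finite_subset[OF sub fin] by auto
  qed
  then show ?thesis using Tn by blast
qed

section \<open>Fixed vectors and the orbit sum\<close>

lemma fixed_by_transitive_subgroup:
  assumes fin: "finite (carrier H)"
    and p: "CHAR('k) = p"
    and sol: "p_soluble p H"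
    and B: "subgroup B H"
    and span: "span (orbit H act a) = UNIV"
    and orb: "\<not> p dvd card (orbit H act a)"
    and trans: "orbit (H\<lparr>carrier := B\<rparr>) act a = orbit H act a"
    and v: "\<And>h. h \<in> B \<Longrightarrow> act h v = v"
  shows "v \<in> span {\<Sum>x\<in>orbit H act a. x}"
proof -
  let ?X = "orbit H act a"
  interpret B: group_module "H\<lparr>carrier := B\<rparr>" scale act by (rule restrict_group_module[OF B])
  interpret A: group_action "H\<lparr>carrier := B\<rparr>" UNIV "\<lambda>h. act (inv\<^bsub>H\<lparr>carrier := B\<rparr>\<^esub> h)"
    by (rule B.group_action_inv)
  have orbB: "orbit (H\<lparr>carrier := B\<rparr>) act x = ?X" if "x \<in> ?X" for x
    using A.orbit_sym[of a x] A.orbit_trans that trans unfolding B.orbit_inv by blast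
  have "invariant_coefficients scale act ?X B"
    by (rule invariant_coefficients_subgroup[OF fin p sol B finite_orbit[OF fin] span])
      (use act_orbit orb orbB in auto)
  then obtain f where f: "\<And>h x. h \<in> B \<Longrightarrow> x \<in> ?X \<Longrightarrow> f (act h x) = f x"
    and vf: "v = (\<Sum>x\<in>?X. f x *s x)"
    using v unfolding invariant_coefficients_def by blast
  have "f x = f a" if "x \<in> ?X" for x
  proof -
    obtain h where "h \<in> B" "x = act h a"
      using \<open>x \<in> ?X\<close> unfolding trans[symmetric] by (auto simp: orbit_def)
    then show ?thesis using f[OF _ orbit_self] by simp
  qed
  then have "v = f a *s (\<Sum>x\<in>?X. x)" using vf by (simp add: scale_sum_right)
  then show ?thesis by (simp add: span_base span_scale)
qed

lemma orbit_sum_fixed: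
  assumes "h \<in> carrier H"
  shows "act h (\<Sum>x\<in>orbit H act a. x) = (\<Sum>x\<in>orbit H act a. x)"
proof -
  interpret L: Vector_Spaces.linear scale scale "act h" using act_linear assms .
  show ?thesis unfolding L.sum
    using assms act_orbit
    by (intro sum.reindex_bij_witness[where i = "act (inv h)" and j = "act h"]) auto
qed

text \<open>
  With \<open>A\<close>, \<open>B\<close> the stabilizers, comparing the two ways up from \<open>A \<inter> B\<close> to \<open>H\<close> shows that
  the index of \<open>A\<close> in \<open>H\<close> divides that of \<open>B\<close> times that of \<open>A \<inter> B\<close> in \<open>B\<close>. By coprimality it
  divides the latter, which is the length of the \<open>B\<close>-orbit of \<open>a\<close>.
\<close>

lemma stabilizer_transitive_of_coprime_orbits:
  assumes fin: "finite (carrier H)"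
    and cop: "coprime (card (orbit H act a)) (card (orbit H act b))"
  shows "orbit (H\<lparr>carrier := stabilizer H act b\<rparr>) act a = orbit H act a"
proof -
  let ?A = "stabilizer H act a" and ?B = "stabilizer H act b"
  let ?oB = "card (orbit (H\<lparr>carrier := ?B\<rparr>) act a)"
  have B: "subgroup ?B H" and A: "subgroup ?A H" by (rule stabilizer_subgroup)+
  interpret B: group_module "H\<lparr>carrier := ?B\<rparr>" scale act by (rule restrict_group_module[OF B])
  interpret gA: group "H\<lparr>carrier := ?A\<rparr>" using A by (rule subgroup_imp_group)
  have "stabilizer (H\<lparr>carrier := ?B\<rparr>) act a = ?A \<inter> ?B"
    by (auto simp: stabilizer_def)
  then have oB: "?oB * card (?A \<inter> ?B) = card ?B"
    using B.orbit_stabilizer[of a] by (simp add: order_def)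
  have "subgroup (?A \<inter> ?B) (H\<lparr>carrier := ?A\<rparr>)"
    using subgroup_incl[OF subgroups_Inter_pair[OF A B] A] by simp
  then obtain c where c: "card ?A = c * card (?A \<inter> ?B)"
    using gA.lagrange[symmetric] by (auto simp: order_def)
  have "finite (?A \<inter> ?B)" "\<one> \<in> ?A \<inter> ?B"
    using fin A B subgroup.one_closed by (auto simp: stabilizer_def)
  then have pos: "card (?A \<inter> ?B) > 0" by (auto simp: card_gt_0_iff)
  have "card (orbit H act a) * card ?A = card (orbit H act b) * card ?B"
    using orbit_stabilizer by simp
  then have "(card (orbit H act a) * c) * card (?A \<inter> ?B) = (card (orbit H act b) * ?oB) * card (?A \<inter> ?B)"
    using c oB by (simp add: mult.assoc)
  then have "card (orbit H act a) * c = card (orbit H act b) * ?oB" using pos by simp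
  then have "card (orbit H act a) dvd ?oB"
    using cop by (metis coprime_dvd_mult_right_iff dvd_triv_left)
  moreover have sub: "orbit (H\<lparr>carrier := ?B\<rparr>) act a \<subseteq> orbit H act a"
    using subgroup.subset[OF B] by (auto simp: orbit_def)
  moreover have "?oB > 0"
    using B.orbit_self[of a] finite_subset[OF sub finite_orbit[OF fin]] by (auto simp: card_gt_0_iff)
  ultimately show ?thesis
    using card_seteq[OF finite_orbit[OF fin] sub] dvd_imp_le by blast
qed

text \<open>
  The stabilizer of \<open>a\<close> already contains the full power of \<open>p\<close> dividing the order of \<open>H\<close>.
\<close>

lemma not_dvd_orbit_if_fixed_by_sylow:
  assumes fin: "finite (carrier H)" and p: "p = 0 \<or> prime p"
    and P: "sylow_subgroup p P H" and fixed: "\<And>h. h \<in> P \<Longrightarrow> act h a = a"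
  shows "\<not> p dvd card (orbit H act a)"
proof (cases "p = 0")
  case True
  then show ?thesis using orbit_self[of a] finite_orbit[OF fin] by auto
next
  case False
  then have pr: "prime p" using p by simp
  have sP: "subgroup P H" and cP: "card P = p ^ multiplicity p (order H)"
    using P False by (simp_all add: sylow_subgroup_def)
  let ?A = "stabilizer H act a"
  interpret gA: group "H\<lparr>carrier := ?A\<rparr>"
    using stabilizer_subgroup by (rule subgroup_imp_group)
  have "P \<subseteq> ?A" using fixed subgroup.subset[OF sP] by (auto simp: stabilizer_def)
  then have "subgroup P (H\<lparr>carrier := ?A\<rparr>)"
    using subgroup_incl[OF sP stabilizer_subgroup] by simp
  then have dvd: "card P dvd card ?A"
    using gA.lagrange[symmetric] by (simp add: order_def)
  show ?thesis
  proof
    assume "p dvd card (orbit H act a)"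
    then have "p * p ^ multiplicity p (order H) dvd order H"
      using dvd orbit_stabilizer[of a] cP by (metis mult_dvd_mono)
    then have "Suc (multiplicity p (order H)) \<le> multiplicity p (order H)"
      using pr fin order_gt_0_iff_finite by (intro multiplicity_geI) auto
    then show False by simp
  qed
qed

end

theorem theorem1p4:
  fixes H :: "('h, 'm) monoid_scheme"
    and scale :: "'k::field \<Rightarrow> 'v::ab_group_add \<Rightarrow> 'v"
    and act :: "'h \<Rightarrow> 'v \<Rightarrow> 'v"
    and p :: nat and a :: 'v
  assumes "CHAR('k) = p"
    and "group_module H scale act"
    and "finite (carrier H)"
    and "p_soluble p H"
    and "\<exists>P. sylow_subgroup p P H \<and> (\<forall>h\<in>P. act h a = a)"
    and "module.span scale (orbit H act a) = UNIV"
  shows "vector_space.dim scale (fixed_points H act) \<le> 1 \<and>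
    (\<forall>b. gcd (card (orbit H act a)) (card (orbit H act b)) = 1 \<longrightarrow> b \<in> fixed_points H act)"
proof -
  interpret group_module H scale act by fact
  let ?s = "\<Sum>x\<in>orbit H act a. x"
  have "p = 0 \<or> prime p" using prime_CHAR_semidom[where 'a = 'k] assms(1) by auto
  then have orb: "\<not> p dvd card (orbit H act a)"
    using not_dvd_orbit_if_fixed_by_sylow assms(3,5) by blast
  note main = fixed_by_transitive_subgroup[OF assms(3,1,4) _ assms(6) orb]
  have "fixed_points H act \<subseteq> span {?s}"
    using main[OF subgroup_self] by (auto simp: fixed_points_def)
  then have "dim (fixed_points H act) \<le> 1"
    using dim_le_card[of _ "{?s}"] by simp
  moreover have "b \<in> fixed_points H act"
    if "gcd (card (orbit H act a)) (card (orbit H act b)) = 1" for b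
  proof -
    have "b \<in> span {?s}"
      using main[OF stabilizer_subgroup
          stabilizer_transitive_of_coprime_orbits[OF assms(3)], of b] that
      by (simp add: coprime_iff_gcd_eq_1 stabilizer_def)
    then obtain c where b: "b = scale c ?s" by (auto simp: span_singleton)
    show ?thesis unfolding fixed_points_def
    proof (intro CollectI ballI)
      fix h assume h: "h \<in> carrier H"
      interpret L: Vector_Spaces.linear scale scale "act h" using act_linear h .
      show "act h b = b" using orbit_sum_fixed[OF h] by (simp add: b L.scale)
    qed
  qed
  ultimately show ?thesis by blast
qed

end
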